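(* Let $(X,d)$ be an infinite metric space, let $\{f_n\}_{n\in\mathbb{N}^+}$ be a sequence of uniformly continuous maps $f_n:X\to X$ which is pointwise weak orbitally convergent to a uniformly continuous map $f:X\to X$, and let $x\in X$. Then $x\in Dc(f)$ (i.e. $x$ is a Devaney chaotic point of $f$) if and only if the following two conditions hold: (1) For every $\epsilon>0$, $\bigcup_{z\in B^{-}(x,\epsilon)}\bigcap_{\delta>0}\bigcup_{m\geq 1}\bigcap_{n\geq m}P(f_n,z,\delta)\neq\emptyset$. (2) For every open set $U$ containing $x$ and every non-empty open set $V$, $\bigcup_{m\geq 1}\bigcap_{n\geq m}Tt(f_n,x,U,V)\neq\emptyset$.
   Context: $\mathbb{N}^+=\{1,2,\dots\}$; $f^k$ denotes the $k$-th iterate. $B^{-}(x,\epsilon)=\{y\in X: 0<d(x,y)<\epsilon\}$. The sequence $f_n$ is pointwise weak orbitally convergent to $f$ if for every $x\in X$, $k\in\mathbb{N}^+$ and $\epsilon>0$ there is $N\in\mathbb{N}^+$ (depending on $x,\epsilon,k$) such that $d(f_n^k(x),f^k(x))<\epsilon$ for all $n\geq N$. For uniformly continuous $g:X\to X$: - $P(g)$ is the set of points $x\in X$ such that every deleted open neighbourhood of $x$ contains a periodic point of $g$. $P(g,z,\delta)=\{k\in\mathbb{N}^+: d(g^k(z),z)<\delta\}$. - $Tt(g)$ is the set of topologically transitive points: those $x$ such that for every open $U\ni x$ and every non-empty open $V$ there is $k\in\mathbb{N}^+$ with $g^k(U)\cap V\neq\emptyset$. $Tt(g,x,U,V)=\{(y,k)\in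 U\times\mathbb{N}^+: g^k(y)\in V\}$. - $Se(g)$ is the set of sensitive points: those $x$ for which there is $\delta>0$ such that for every open set $U\ni x$ there is $y\in U$ with $d(g^n(x),g^n(y))>\delta$ for some $n\in\mathbb{N}^+$. - $Dc(g)=Tt(g)\cap P(g)\cap Se(g)$ is the set of Devaney chaotic points. *)

theory Defs
  imports Complex_Main
begin

(* The metric space X is the carrier of a type of class metric_space. The positive
   naturals are the set {1..} of nat; values of sequences at index 0 are irrelevant. *)

definition deleted_ball :: "'a::metric_space \<Rightarrow> real \<Rightarrow> 'a set" where
  "deleted_ball x \<epsilon> = {y. 0 < dist x y \<and> dist x y < \<epsilon>}"

definition pointwise_weak_orbitally_convergent ::
  "(nat \<Rightarrow> 'a \<Rightarrow> 'a) \<Rightarrow> ('a \<Rightarrow> 'a::metric_space) \<Rightarrow> bool" where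
  "pointwise_weak_orbitally_convergent f g \<longleftrightarrow>
     (\<forall>x. \<forall>k\<ge>1. \<forall>\<epsilon>>0. \<exists>N\<ge>1. \<forall>n\<ge>N. dist ((f n ^^ k) x) ((g ^^ k) x) < \<epsilon>)"

definition periodic_point :: "('a \<Rightarrow> 'a) \<Rightarrow> 'a \<Rightarrow> bool" where
  "periodic_point g z \<longleftrightarrow> (\<exists>k\<ge>1. (g ^^ k) z = z)"

definition periodic_limit_points :: "('a \<Rightarrow> 'a::metric_space) \<Rightarrow> 'a set" where
  "periodic_limit_points g =
     {x. \<forall>U. open U \<and> x \<in> U \<longrightarrow> (\<exists>z\<in>U - {x}. periodic_point g z)}"

definition return_times :: "('a \<Rightarrow> 'a::metric_space) \<Rightarrow> 'a \<Rightarrow> real \<Rightarrow> nat set" where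
  "return_times g z \<delta> = {k. 1 \<le> k \<and> dist ((g ^^ k) z) z < \<delta>}"

definition transitive_points :: "('a \<Rightarrow> 'a::metric_space) \<Rightarrow> 'a set" where
  "transitive_points g =
     {x. \<forall>U V. open U \<and> x \<in> U \<and> open V \<and> V \<noteq> {} \<longrightarrow> (\<exists>k\<ge>1. (g ^^ k) ` U \<inter> V \<noteq> {})}"

(* As in the source, the point x is carried as an argument although the value depends
   only on g, U and V. *)
definition transit_pairs ::
  "('a \<Rightarrow> 'a) \<Rightarrow> 'a \<Rightarrow> 'a set \<Rightarrow> 'a set \<Rightarrow> ('a \<times> nat) set" where
  "transit_pairs g x U V = {(y, k). y \<in> U \<and> 1 \<le> k \<and> (g ^^ k) y \<in> V}"

definition sensitive_points :: "('a \<Rightarrow> 'a::metric_space) \<Rightarrow> 'a set" where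
  "sensitive_points g =
     {x. \<exists>\<delta>>0. \<forall>U. open U \<and> x \<in> U \<longrightarrow>
           (\<exists>y\<in>U. \<exists>n\<ge>1. dist ((g ^^ n) x) ((g ^^ n) y) > \<delta>)}"

definition devaney_chaotic_points :: "('a \<Rightarrow> 'a::metric_space) \<Rightarrow> 'a set" where
  "devaney_chaotic_points g =
     transitive_points g \<inter> periodic_limit_points g \<inter> sensitive_points g"

end

theory Submission
  imports Defs "HOL-Analysis.Elementary_Metric_Spaces"
begin

text \<open>
  For a fixed \<open>k\<close> the values \<open>f\<^sub>n\<^sup>k(z)\<close> converge to \<open>g\<^sup>k(z)\<close>, so (1) says that \<open>x\<close> is a limit of
  periodic points of \<open>g\<close>, and (2), applied to a ball whose closure lies in the target set, says that
  \<open>x\<close> is a transitive point of \<open>g\<close>. Sensitivity at \<open>x\<close> is then automatic by a pointwise version of the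
  argument of Banks, Brooks, Cairns, Davis and Stacey: some periodic orbit stays away from \<open>x\<close>, and
  by transitivity a point near \<open>x\<close> shadows that orbit for a full period of a periodic point near \<open>x\<close>.
\<close>

section \<open>Periodic orbits\<close>

lemma funpow_funpow_apply: "(g ^^ m) ((g ^^ n) z) = (g ^^ (m + n)) z"
  by (simp add: funpow_add)

lemma funpow_mult_fixed:
  assumes "(g ^^ k) q = q"
  shows "(g ^^ (k * j)) q = q"
  using funpow_mod_eq[OF assms, of "k * j"] by simp

lemma finite_periodic_orbit:
  assumes "periodic_point g q"
  shows "finite (range (\<lambda>i. (g ^^ i) q))"
proof -
  obtain k where k: "k \<ge> 1" "(g ^^ k) q = q"
    using assms unfolding periodic_point_def by blast
  have "range (\<lambda>i. (g ^^ i) q) \<subseteq> (\<lambda>i. (g ^^ i) q) ` {..<k}"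
  proof (rule image_subsetI)
    fix i
    have "(g ^^ i) q = (g ^^ (i mod k)) q"
      using funpow_mod_eq[OF k(2)] by simp
    moreover have "i mod k \<in> {..<k}"
      using k(1) by simp
    ultimately show "(g ^^ i) q \<in> (\<lambda>i. (g ^^ i) q) ` {..<k}"
      by (rule image_eqI)
  qed
  then show ?thesis
    by (rule finite_subset) simp
qed

text \<open>Iterates of \<open>g\<close> commute, so a period of \<open>q\<close> is a period of
  every point on its orbit; going on around the cycle from \<open>x\<close> leads back to
  \<open>q\<close>.\<close>

lemma periodic_orbit_symmetric:
  assumes "periodic_point g q" "(g ^^ i) q = x"
  shows "periodic_point g x" "q \<in> range (\<lambda>i. (g ^^ i) x)"
proof -
  obtain k where k: "k \<ge> 1" "(g ^^ k) q = q"
    using assms(1) unfolding periodic_point_def by blast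
  have "(g ^^ k) ((g ^^ i) q) = (g ^^ i) ((g ^^ k) q)"
    by (simp only: funpow_funpow_apply add.commute)
  then have "(g ^^ k) x = x"
    by (simp only: k(2) assms(2))
  with k(1) show "periodic_point g x"
    unfolding periodic_point_def by blast
  \<comment> \<open>This makes the natural number subtraction \<open>k * i - i\<close> exact: it
    counts the remaining steps from \<open>x\<close> to \<open>(g ^^ (k * i)) q\<close>, which is
    \<open>q\<close>.\<close>
  have "i \<le> k * i"
    using k(1) by simp
  then have "(g ^^ (k * i - i)) x = (g ^^ (k * i)) q"
    unfolding assms(2)[symmetric] funpow_funpow_apply by simp
  then have "q = (g ^^ (k * i - i)) x"
    using funpow_mult_fixed[OF k(2)] by simp
  then show "q \<in> range (\<lambda>i. (g ^^ i) x)"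
    by blast
qed

text \<open>A periodic orbit through \<open>x\<close> forces \<open>x\<close> to be periodic and
  lies in the orbit of \<open>x\<close>. So any periodic \<open>q\<close> works if \<open>x\<close>
  is not periodic; otherwise it suffices to take \<open>q\<close> off the orbit of
  \<open>x\<close>.\<close>

lemma ex_periodic_orbit_avoiding:
  fixes g :: "'a \<Rightarrow> 'a::metric_space"
  assumes "x \<in> periodic_limit_points g"
  obtains q where "periodic_point g q" "x \<notin> range (\<lambda>i. (g ^^ i) q)"
proof (cases "periodic_point g x")
  case True
  \<comment> \<open>The orbit of \<open>x\<close> is finite, so deleting its other points leaves a
    neighbourhood of \<open>x\<close>.\<close>
  let ?U = "- (range (\<lambda>i. (g ^^ i) x) - {x})"
  have "open ?U"
    using finite_periodic_orbit[OF True] by (intro open_Compl finite_imp_closed finite_Diff)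
  then obtain q where q: "q \<in> ?U - {x}" "periodic_point g q"
    using assms unfolding periodic_limit_points_def by blast
  have "x \<notin> range (\<lambda>i. (g ^^ i) q)"
    using periodic_orbit_symmetric(2)[OF q(2)] q(1) by blast
  with q(2) show ?thesis by (rule that)
next
  case False
  obtain q where q: "periodic_point g q"
    using assms unfolding periodic_limit_points_def by blast
  have "x \<notin> range (\<lambda>i. (g ^^ i) q)"
    using periodic_orbit_symmetric(1)[OF q] False by auto
  with q show ?thesis by (rule that)
qed

section \<open>Sensitivity from transitivity and nearby periodic points\<close>

lemma continuous_on_funpow:
  fixes g :: "'a \<Rightarrow> 'a::topological_space"
  assumes "continuous_on UNIV g"
  shows "continuous_on UNIV (g ^^ k)"
proof (induction k)
  case (Suc k)
  then show ?case
    using assms by (auto intro: continuous_on_compose2 simp: comp_def)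
qed (simp add: id_def)

text \<open>At a common time \<open>N\<close> a periodic point \<open>p\<close> near
  \<open>x\<close> is back at \<open>p\<close>, while another point \<open>y\<close> near
  \<open>x\<close> is close to the far orbit of \<open>q\<close>. The orbit of \<open>x\<close>
  cannot follow both.\<close>

lemma transitive_periodic_limit_imp_sensitive:
  fixes g :: "'a \<Rightarrow> 'a::metric_space"
  assumes cont: "continuous_on UNIV g"
    and trans: "x \<in> transitive_points g" and per: "x \<in> periodic_limit_points g"
  shows "x \<in> sensitive_points g"
proof -
  obtain q where q: "periodic_point g q" "x \<notin> range (\<lambda>i. (g ^^ i) q)"
    using ex_periodic_orbit_avoiding[OF per] .
  have "open (- range (\<lambda>i. (g ^^ i) q))"
    using finite_periodic_orbit[OF q(1)] by (simp add: finite_imp_closed open_Compl)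
  with q(2) obtain e where e: "e > 0" "\<And>y. dist y x < e \<Longrightarrow> y \<notin> range (\<lambda>i. (g ^^ i) q)"
    unfolding open_dist by blast
  \<comment> \<open>Quarters, because the triangle inequality below has four terms;
    \<open>\<delta>\<close> depends on \<open>q\<close> only and is fixed before
    \<open>U\<close>.\<close>
  define \<delta> where "\<delta> = e / 4"
  have \<delta>: "\<delta> > 0" using e(1) by (simp add: \<delta>_def)
  have far: "dist ((g ^^ i) q) x \<ge> 4 * \<delta>" for i
    using e(2)[of "(g ^^ i) q"] by (force simp: \<delta>_def)
  have "\<exists>y\<in>U. \<exists>n\<ge>1. dist ((g ^^ n) x) ((g ^^ n) y) > \<delta>" if U: "open U" "x \<in> U" for U
  proof -
    define W where "W = U \<inter> ball x \<delta>"
    have W: "open W" "x \<in> W"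
      using U \<delta> by (auto simp: W_def)
    obtain p where p: "p \<in> W" "periodic_point g p"
      using per W unfolding periodic_limit_points_def by blast
    then obtain n where n: "n \<ge> 1" "(g ^^ n) p = p"
      unfolding periodic_point_def by blast
    \<comment> \<open>Points that follow \<open>q\<close> within \<open>\<delta>\<close> at all
      times up to \<open>n\<close>, a full period of \<open>p\<close>.\<close>
    define V where "V = (\<Inter>i\<in>{..n}. (g ^^ i) -` ball ((g ^^ i) q) \<delta>)"
    have "open V"
      unfolding V_def
      by (intro open_INT ballI open_vimage continuous_on_funpow cont) auto
    moreover have "q \<in> V"
      using \<delta> by (simp add: V_def)
    ultimately obtain k y where y: "y \<in> W" "(g ^^ k) y \<in> V"
      using trans W unfolding transitive_points_def by blast
    \<comment> \<open>The least multiple of \<open>n\<close> exceeding \<open>k\<close>: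
      \<open>p\<close> returns at time \<open>N\<close>, and \<open>N - k\<close> falls within the
      times controlled by \<open>V\<close>. The \<open>+ 1\<close> also gives
      \<open>N \<ge> 1\<close> when \<open>k\<close> is 0.\<close>
    define N where "N = n * (k div n + 1)"
    have N: "N \<ge> 1" "k \<le> N" "N - k \<le> n"
    proof -
      have "N = k - k mod n + n"
        by (simp add: N_def minus_mod_eq_mult_div[symmetric] algebra_simps)
      moreover have "k mod n < n" "k mod n \<le> k"
        using n(1) by simp_all
      ultimately show "N \<ge> 1" "k \<le> N" "N - k \<le> n"
        by linarith+
    qed
    have "(g ^^ N) y = (g ^^ (N - k)) ((g ^^ k) y)"
      using N(2) by (simp add: funpow_funpow_apply)
    then have 1: "dist ((g ^^ (N - k)) q) ((g ^^ N) y) < \<delta>"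
      using y(2) N(3) by (auto simp: V_def)
    have 2: "(g ^^ N) p = p"
      unfolding N_def using n(2) by (rule funpow_mult_fixed)
    have 3: "dist x p < \<delta>"
      using p(1) by (simp add: W_def)
    have "4 * \<delta> \<le> dist ((g ^^ (N - k)) q) ((g ^^ N) y) + dist ((g ^^ N) y) ((g ^^ N) x)
      + dist ((g ^^ N) x) ((g ^^ N) p) + dist p x"
      using far[of "N - k"] dist_triangle[of "(g ^^ (N - k)) q" x "(g ^^ N) y"]
        dist_triangle[of "(g ^^ N) y" x "(g ^^ N) x"] dist_triangle[of "(g ^^ N) x" x p] 2
      by simp
    \<comment> \<open>The outer two of the four terms are below \<open>\<delta>\<close>, so the
      inner two sum to more than 2 \<open>\<delta>\<close>. Either \<open>y\<close> or
      \<open>p\<close> then witnesses sensitivity.\<close>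
    then have "dist ((g ^^ N) x) ((g ^^ N) y) > \<delta> \<or> dist ((g ^^ N) x) ((g ^^ N) p) > \<delta>"
      using 1 3 by (simp add: dist_commute) linarith
    then show ?thesis
      using y(1) p(1) N(1) unfolding W_def by blast
  qed
  with \<delta> show ?thesis
    unfolding sensitive_points_def by blast
qed

section \<open>Passing between the sequence and its limit map\<close>

lemma pointwise_weak_orbitally_convergent_imp_tendsto:
  assumes "pointwise_weak_orbitally_convergent f g" "k \<ge> 1"
  shows "(\<lambda>n. (f n ^^ k) z) \<longlonglongrightarrow> (g ^^ k) z"
  unfolding lim_sequentially
proof (intro allI impI)
  fix \<epsilon> :: real assume "\<epsilon> > 0"
  then obtain N where "\<forall>n\<ge>N. dist ((f n ^^ k) z) ((g ^^ k) z) < \<epsilon>"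
    using assms unfolding pointwise_weak_orbitally_convergent_def by meson
  then show "\<exists>N. \<forall>n\<ge>N. dist ((f n ^^ k) z) ((g ^^ k) z) < \<epsilon>"
    by blast
qed

lemma periodic_limit_points_iff_deleted_ball:
  "x \<in> periodic_limit_points g \<longleftrightarrow> (\<forall>\<epsilon>>0. \<exists>z\<in>deleted_ball x \<epsilon>. periodic_point g z)"
proof
  assume L: "x \<in> periodic_limit_points g"
  show "\<forall>\<epsilon>>0. \<exists>z\<in>deleted_ball x \<epsilon>. periodic_point g z"
  proof (intro allI impI)
    fix \<epsilon> :: real assume "\<epsilon> > 0"
    then have "open (ball x \<epsilon>) \<and> x \<in> ball x \<epsilon>"
      by simp
    then obtain z where "z \<in> ball x \<epsilon> - {x}" "periodic_point g z"
      using L unfolding periodic_limit_points_def by blast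
    then show "\<exists>z\<in>deleted_ball x \<epsilon>. periodic_point g z"
      unfolding deleted_ball_def by auto
  qed
next
  assume R: "\<forall>\<epsilon>>0. \<exists>z\<in>deleted_ball x \<epsilon>. periodic_point g z"
  have "\<exists>z\<in>U - {x}. periodic_point g z" if U: "open U" "x \<in> U" for U
  proof -
    obtain e where e: "e > 0" "\<And>y. dist y x < e \<Longrightarrow> y \<in> U"
      using U unfolding open_dist by blast
    obtain z where "z \<in> deleted_ball x e" "periodic_point g z"
      using R e(1) by blast
    then show ?thesis
      using e(2)[of z] by (auto simp: deleted_ball_def dist_commute)
  qed
  then show "x \<in> periodic_limit_points g"
    unfolding periodic_limit_points_def by blast
qed

text \<open>Turns the unions over \<open>m\<close> of intersections over \<open>n\<close> in both
  conditions into statements about limits.\<close>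

lemma eventually_sequentially_ge_1:
  "(\<forall>\<^sub>F n in sequentially. P n) \<longleftrightarrow> (\<exists>m\<ge>1. \<forall>n\<ge>m. P n)"
proof
  assume "\<forall>\<^sub>F n in sequentially. P n"
  then obtain m where "\<forall>n\<ge>m. P n"
    unfolding eventually_sequentially by blast
  then have "max 1 m \<ge> 1 \<and> (\<forall>n\<ge>max 1 m. P n)"
    by simp
  then show "\<exists>m\<ge>1. \<forall>n\<ge>m. P n"
    by blast
qed (auto simp: eventually_sequentially)

text \<open>The set on the right consists exactly of the periods of \<open>z\<close> under
  \<open>g\<close>: its element \<open>k\<close> is fixed before \<open>\<delta>\<close>, so
  membership says that \<open>(f n ^^ k) z\<close> tends to \<open>z\<close>, and limits are
  unique.\<close>

lemma periodic_point_iff_return_times: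
  assumes "pointwise_weak_orbitally_convergent f g"
  shows "periodic_point g z \<longleftrightarrow>
    (\<Inter>\<delta>\<in>{0<..}. \<Union>m\<in>{1..}. \<Inter>n\<in>{m..}. return_times (f n) z \<delta>) \<noteq> {}"
proof -
  have "k \<in> (\<Inter>\<delta>\<in>{0<..}. \<Union>m\<in>{1..}. \<Inter>n\<in>{m..}. return_times (f n) z \<delta>) \<longleftrightarrow>
      k \<ge> 1 \<and> (g ^^ k) z = z" for k
  proof -
    have "k \<in> (\<Inter>\<delta>\<in>{0<..}. \<Union>m\<in>{1..}. \<Inter>n\<in>{m..}. return_times (f n) z \<delta>) \<longleftrightarrow>
        (\<forall>\<delta>>0. \<forall>\<^sub>F n in sequentially. 1 \<le> k \<and> dist ((f n ^^ k) z) z < \<delta>)"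
      unfolding eventually_sequentially_ge_1
      by (simp only: INT_iff UN_iff return_times_def mem_Collect_eq Bex_def Ball_def
          greaterThan_iff atLeast_iff)
    \<comment> \<open>The instance \<open>\<delta> = 1\<close> extracts \<open>k \<ge> 1\<close>
      from under the quantifier.\<close>
    also have "\<dots> \<longleftrightarrow> k \<ge> 1 \<and> (\<lambda>n. (f n ^^ k) z) \<longlonglongrightarrow> z"
      unfolding tendsto_iff eventually_conj_iff by (auto dest: spec[of _ 1])
    also have "\<dots> \<longleftrightarrow> k \<ge> 1 \<and> (g ^^ k) z = z"
      using pointwise_weak_orbitally_convergent_imp_tendsto[OF assms] LIMSEQ_unique by metis
    finally show ?thesis .
  qed
  then show ?thesis
    unfolding periodic_point_def by blast
qed

lemma transit_pairs_eventually_iff: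
  "(\<Union>m\<in>{1..}. \<Inter>n\<in>{m..}. transit_pairs (f n) x U V) \<noteq> {} \<longleftrightarrow>
    (\<exists>y\<in>U. \<exists>k\<ge>1. \<forall>\<^sub>F n in sequentially. (f n ^^ k) y \<in> V)"
proof -
  have eq: "(\<Union>m\<in>{1..}. \<Inter>n\<in>{m..}. transit_pairs (f n) x U V) =
    {(y, k). y \<in> U \<and> k \<ge> 1 \<and> (\<forall>\<^sub>F n in sequentially. (f n ^^ k) y \<in> V)}"
    unfolding eventually_sequentially_ge_1
    by (auto simp: transit_pairs_def Bex_def Ball_def)
  show ?thesis
    unfolding eq by blast
qed

text \<open>The same pair \<open>(y, k)\<close> serves \<open>g\<close> and almost all
  \<open>f n\<close>. Openness of \<open>V\<close> suffices from \<open>g\<close> to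
  \<open>f n\<close>; the converse first shrinks \<open>V\<close>, since a limit of points of
  \<open>V\<close> may leave it.\<close>

lemma transitive_points_iff_transit_pairs:
  fixes g :: "'a \<Rightarrow> 'a::metric_space"
  assumes "pointwise_weak_orbitally_convergent f g"
  shows "x \<in> transitive_points g \<longleftrightarrow>
    (\<forall>U V. open U \<and> x \<in> U \<and> open V \<and> V \<noteq> {} \<longrightarrow>
       (\<Union>m\<in>{1..}. \<Inter>n\<in>{m..}. transit_pairs (f n) x U V) \<noteq> {})"
  unfolding transit_pairs_eventually_iff
proof (intro iffI allI impI)
  fix U V :: "'a set"
  assume "x \<in> transitive_points g" and UV: "open U \<and> x \<in> U \<and> open V \<and> V \<noteq> {}"
  then have "\<exists>k\<ge>1. (g ^^ k) ` U \<inter> V \<noteq> {}"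
    unfolding transitive_points_def by blast
  then obtain y k where "y \<in> U" "k \<ge> 1" "(g ^^ k) y \<in> V"
    by blast
  moreover from this have "\<forall>\<^sub>F n in sequentially. (f n ^^ k) y \<in> V"
    using topological_tendstoD[OF pointwise_weak_orbitally_convergent_imp_tendsto[OF assms]] UV
    by blast
  ultimately show "\<exists>y\<in>U. \<exists>k\<ge>1. \<forall>\<^sub>F n in sequentially. (f n ^^ k) y \<in> V"
    by blast
next
  assume R: "\<forall>U V. open U \<and> x \<in> U \<and> open V \<and> V \<noteq> {} \<longrightarrow>
    (\<exists>y\<in>U. \<exists>k\<ge>1. \<forall>\<^sub>F n in sequentially. (f n ^^ k) y \<in> V)"
  have "\<exists>k\<ge>1. (g ^^ k) ` U \<inter> V \<noteq> {}"
    if UV: "open U" "x \<in> U" "open V" "V \<noteq> {}" for U V :: "'a set"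
  proof -
    obtain v e where e: "e > 0" "\<And>y. dist y v < e \<Longrightarrow> y \<in> V"
      using UV(3,4) unfolding open_dist by blast
    have "open (ball v (e / 2))" "ball v (e / 2) \<noteq> {}"
      using e(1) by auto
    then obtain y k where y: "y \<in> U" "k \<ge> 1"
        "\<forall>\<^sub>F n in sequentially. (f n ^^ k) y \<in> ball v (e / 2)"
      using R UV(1,2) by meson
    have "(\<lambda>n. dist v ((f n ^^ k) y)) \<longlonglongrightarrow> dist v ((g ^^ k) y)"
      by (intro tendsto_intros pointwise_weak_orbitally_convergent_imp_tendsto assms y(2))
    \<comment> \<open>Only the weak inequality survives the limit; \<open>e / 2 < e\<close> still
      places the limit in \<open>V\<close>.\<close>
    moreover have "\<forall>\<^sub>F n in sequentially. dist v ((f n ^^ k) y) \<le> e / 2"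
      using y(3) by eventually_elim simp
    ultimately have "dist v ((g ^^ k) y) \<le> e / 2"
      by (intro tendsto_upperbound) auto
    then have "(g ^^ k) y \<in> V"
      using e by (simp add: dist_commute)
    then show ?thesis
      using y by blast
  qed
  then show "x \<in> transitive_points g"
    unfolding transitive_points_def by blast
qed

theorem corollary3p4:
  fixes f :: "nat \<Rightarrow> 'a \<Rightarrow> 'a::metric_space"
    and g :: "'a \<Rightarrow> 'a"
    and x :: 'a
  assumes "infinite (UNIV :: 'a set)"
    and "\<And>n. n \<ge> 1 \<Longrightarrow> uniformly_continuous_on UNIV (f n)"
    and "uniformly_continuous_on UNIV g"
    and "pointwise_weak_orbitally_convergent f g"
  shows "x \<in> devaney_chaotic_points g \<longleftrightarrow>
    (\<forall>\<epsilon>>0. (\<Union>z\<in>deleted_ball x \<epsilon>. \<Inter>\<delta>\<in>{0<..}. \<Union>m\<in>{1..}. \<Inter>n\<in>{m..}.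
               return_times (f n) z \<delta>) \<noteq> {}) \<and>
    (\<forall>U V. open U \<and> x \<in> U \<and> open V \<and> V \<noteq> {} \<longrightarrow>
       (\<Union>m\<in>{1..}. \<Inter>n\<in>{m..}. transit_pairs (f n) x U V) \<noteq> {})"
proof -
  have "x \<in> devaney_chaotic_points g \<longleftrightarrow> x \<in> periodic_limit_points g \<and> x \<in> transitive_points g"
    using transitive_periodic_limit_imp_sensitive uniformly_continuous_imp_continuous[OF assms(3)]
    unfolding devaney_chaotic_points_def by blast
  also have "x \<in> periodic_limit_points g \<longleftrightarrow>
      (\<forall>\<epsilon>>0. (\<Union>z\<in>deleted_ball x \<epsilon>. \<Inter>\<delta>\<in>{0<..}. \<Union>m\<in>{1..}. \<Inter>n\<in>{m..}.
         return_times (f n) z \<delta>) \<noteq> {})"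
    unfolding periodic_limit_points_iff_deleted_ball periodic_point_iff_return_times[OF assms(4)]
    by (simp only: UNION_empty_conv ball_simps)
  also note transitive_points_iff_transit_pairs[OF assms(4), of x]
  finally show ?thesis .
qed

end
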